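(* Let $C=(\alpha_1,\alpha_2,\alpha_3,\alpha_4)$, with $0<\alpha_i<\pi$ for $i=1,\ldots,4$, be a degree-4 rigid origami vertex, and let $C^*=(\pi-\alpha_1,\pi-\alpha_2,\pi-\alpha_3,\pi-\alpha_4)$ be its dual vertex. Then the rigid folding kinematics of $C$ and $C^*$ are essentially equivalent, meaning that their configuration spaces $S(C),S(C^* )\subset[-\pi,\pi]^4$ are the same up to a change of sign in the coordinates: there exist signs $\varepsilon_1,\varepsilon_2,\varepsilon_3,\varepsilon_4\in\{1,-1\}$ such that $$S(C^* )=\{(\varepsilon_1\rho_1,\varepsilon_2\rho_2,\varepsilon_3\rho_3,\varepsilon_4\rho_4) : (\rho_1,\rho_2,\rho_3,\rho_4)\in S(C)\}.$$
   Context: A degree-4 rigid origami vertex is a polyhedral cone surface with a single interior vertex at which four rigid planar sectors meet, consecutive sectors being hinged along four creases (rays from the vertex). It is completely determined by its sector angles in cyclic order and is written $C=(\alpha_1,\alpha_2,\alpha_3,\alpha_4)$. The sum $\sum_i\alpha_i$ need not be $2\pi$: the vertex is called Euclidean, elliptic or hyperbolic according to whether the sum is equal to, less than or greater than $2\pi$. The crease $c_i$ lies between the sectors with angles $\alpha_i$ and $\alpha_{i+1}$ (indices cyclic modulo 4), and the same indexing convention is used for $C^*$, with $\pi-\alpha_i$ in place of $\alpha_i$. The crease $c_i$ is folded by a signed folding angle $\rho_i\in[-\pi,\pi]$, where $\rho_i=0$ means that the crease is unfolded, $\rho_i>0$ that it is a valley crease and $\rho_i<0$ that it is a mountain crease.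 The configuration space $S(C)$ is the set of all folding-angle vectors $(\rho_1,\rho_2,\rho_3,\rho_4)\in[-\pi,\pi]^4$ that are viable for rigid foldings of $C$, i.e. for which the four rigid sectors, hinged consecutively with these folding angles, close up around the vertex (self-intersection of the material is not excluded). Explicitly, let $R_z(\theta),R_x(\theta)\in SO(3)$ denote rotation by angle $\theta$ about the $z$-axis and the $x$-axis, respectively. Then $$S(C)=\{(\rho_1,\ldots,\rho_4)\in[-\pi,\pi]^4 : R_z(\alpha_1)R_x(\rho_1)R_z(\alpha_2)R_x(\rho_2)R_z(\alpha_3)R_x(\rho_3)R_z(\alpha_4)R_x(\rho_4)=I\}.$$ The set $S(C^* )$ is defined by the same formula with each $\alpha_i$ replaced by $\pi-\alpha_i$. *)

theory Defs
  imports "HOL-Analysis.Analysis"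
begin

definition rot_x :: "real \<Rightarrow> real^3^3" where
  "rot_x \<theta> = vector [vector [1, 0, 0],
                      vector [0, cos \<theta>, - sin \<theta>],
                      vector [0, sin \<theta>, cos \<theta>]]"

definition rot_z :: "real \<Rightarrow> real^3^3" where
  "rot_z \<theta> = vector [vector [cos \<theta>, - sin \<theta>, 0],
                      vector [sin \<theta>, cos \<theta>, 0],
                      vector [0, 0, 1]]"

text \<open>
  A degree-4 vertex is represented by the vector of its sector angles in cyclic order, and a
  folded state by the vector of its signed folding angles, crease \<open>i\<close> lying between sectors \<open>i\<close>
  and \<open>i + 1\<close>. In the index type \<open>4\<close> the numerals 1, 2, 3, 4 are the four distinct elements, and
  addition is modulo 4.
\<close>

definition closes_up :: "real^4 \<Rightarrow> real^4 \<Rightarrow> bool" where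
  "closes_up \<alpha> \<rho> \<longleftrightarrow>
     rot_z (\<alpha> $ 1) ** rot_x (\<rho> $ 1) ** rot_z (\<alpha> $ 2) ** rot_x (\<rho> $ 2) **
     rot_z (\<alpha> $ 3) ** rot_x (\<rho> $ 3) ** rot_z (\<alpha> $ 4) ** rot_x (\<rho> $ 4) = mat 1"

definition config_space :: "real^4 \<Rightarrow> (real^4) set" where
  "config_space \<alpha> = {\<rho>. (\<forall>i. \<rho> $ i \<in> {-pi..pi}) \<and> closes_up \<alpha> \<rho>}"

definition dual_vertex :: "real^4 \<Rightarrow> real^4" where
  "dual_vertex \<alpha> = (\<chi> i. pi - \<alpha> $ i)"

end

theory Submission imports Defs begin

text \<open>
  Write \<open>Y\<close> for the half turn about the second axis. Two consecutive sectors satisfy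
  \<open>R\<^sub>z(\<pi> - a) R\<^sub>x(r) R\<^sub>z(\<pi> - b) R\<^sub>x(s) = Y R\<^sub>z(a) R\<^sub>x(r) R\<^sub>z(b) R\<^sub>x(-s) Y\<close>. Hence the closing
  product of the dual vertex is the conjugate by \<open>Y\<close> of the closing product of the original
  vertex with the second and fourth folding angles negated.
\<close>

definition half_turn_y :: "real^3^3" where
  "half_turn_y = vector [vector [-1, 0, 0], vector [0, 1, 0], vector [0, 0, -1]]"

lemma half_turn_y_involution: "half_turn_y ** half_turn_y = mat 1"
  by (simp add: half_turn_y_def matrix_matrix_mult_def mat_def vec_eq_iff forall_3 sum_3 vector_3)

text \<open>With \<open>X\<close> and \<open>Z\<close> the half turns about the first and third
  axes, \<open>rot_z (pi - a)\<close> equals \<open>Y ** rot_z a ** X\<close>. Now \<open>X\<close>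
  commutes with \<open>rot_x r\<close>, the product \<open>X ** Y = Z\<close> commutes with
  \<open>rot_z b\<close>, and \<open>Z ** X = Y\<close> moves past \<open>rot_x s\<close> by
  negating \<open>s\<close>. A single sector would leave \<open>Y\<close> on the left but
  \<open>X\<close> on the right; a pair leaves \<open>Y\<close> on both sides.\<close>

lemma dual_sector_pair:
  "rot_z (pi - a) ** rot_x r ** rot_z (pi - b) ** rot_x s =
   half_turn_y ** (rot_z a ** rot_x r ** rot_z b ** rot_x (- s)) ** half_turn_y"
  by (simp add: half_turn_y_def rot_x_def rot_z_def matrix_matrix_mult_def vec_eq_iff forall_3
      sum_3 vector_3 algebra_simps)

lemma conj_half_turn_y_eq_mat_1_iff:
  "half_turn_y ** A ** half_turn_y = mat 1 \<longleftrightarrow> A = mat 1"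
proof
  assume "half_turn_y ** A ** half_turn_y = mat 1"
  then have "half_turn_y ** (half_turn_y ** A ** half_turn_y) ** half_turn_y = mat 1"
    by (simp add: half_turn_y_involution)
  moreover have "half_turn_y ** (half_turn_y ** A ** half_turn_y) ** half_turn_y =
      (half_turn_y ** half_turn_y) ** A ** (half_turn_y ** half_turn_y)"
    by (simp only: matrix_mul_assoc)
  ultimately show "A = mat 1"
    by (simp add: half_turn_y_involution)
qed (simp add: half_turn_y_involution)

definition alt_sign :: "real^4" where
  "alt_sign = (\<chi> i. if i = 2 \<or> i = 4 then -1 else 1)"

lemma alt_sign_nth [simp]:
  "alt_sign $ 1 = 1" "alt_sign $ 2 = -1" "alt_sign $ 3 = 1" "alt_sign $ 4 = -1"
  by (simp_all add: alt_sign_def)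

lemma closes_up_dual_vertex_iff:
  "closes_up (dual_vertex \<alpha>) \<rho> \<longleftrightarrow> closes_up \<alpha> (\<chi> i. alt_sign $ i * \<rho> $ i)"
proof -
  \<comment> \<open>\<open>P\<close> and \<open>Q\<close> are the halves of the closing product of
    \<alpha> itself, with the sign changes already made.\<close>
  define P where "P = rot_z (\<alpha> $ 1) ** rot_x (\<rho> $ 1) ** rot_z (\<alpha> $ 2) ** rot_x (- \<rho> $ 2)"
  define Q where "Q = rot_z (\<alpha> $ 3) ** rot_x (\<rho> $ 3) ** rot_z (\<alpha> $ 4) ** rot_x (- \<rho> $ 4)"
  have "closes_up (dual_vertex \<alpha>) \<rho> \<longleftrightarrow>
      (rot_z (pi - \<alpha> $ 1) ** rot_x (\<rho> $ 1) ** rot_z (pi - \<alpha> $ 2) ** rot_x (\<rho> $ 2)) **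
      (rot_z (pi - \<alpha> $ 3) ** rot_x (\<rho> $ 3) ** rot_z (pi - \<alpha> $ 4) ** rot_x (\<rho> $ 4)) = mat 1"
    by (simp add: closes_up_def dual_vertex_def matrix_mul_assoc)
  also have "\<dots> \<longleftrightarrow>
      (half_turn_y ** P ** half_turn_y) ** (half_turn_y ** Q ** half_turn_y) = mat 1"
    by (simp only: dual_sector_pair P_def Q_def vector_uminus_component)
  \<comment> \<open>Reassociating brings the two inner half turns together; they cancel next,
    leaving one conjugation of \<open>P ** Q\<close>.\<close>
  also have "(half_turn_y ** P ** half_turn_y) ** (half_turn_y ** Q ** half_turn_y) =
      half_turn_y ** (P ** (half_turn_y ** half_turn_y) ** Q) ** half_turn_y"
    by (simp only: matrix_mul_assoc)
  also have "\<dots> = mat 1 \<longleftrightarrow> P ** Q = mat 1"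
    by (simp add: half_turn_y_involution conj_half_turn_y_eq_mat_1_iff)
  also have "\<dots> \<longleftrightarrow> closes_up \<alpha> (\<chi> i. alt_sign $ i * \<rho> $ i)"
    by (simp add: closes_up_def P_def Q_def matrix_mul_assoc)
  finally show ?thesis .
qed

text \<open>The interval from -pi to pi is symmetric, so sign changes affect only the closing
  condition.\<close>

lemma config_space_dual_vertex_iff:
  "\<rho> \<in> config_space (dual_vertex \<alpha>) \<longleftrightarrow> (\<chi> i. alt_sign $ i * \<rho> $ i) \<in> config_space \<alpha>"
  by (auto simp: config_space_def closes_up_dual_vertex_iff forall_4)

theorem theorem5:
  fixes \<alpha> :: "real^4"
  assumes "\<forall>i. 0 < \<alpha> $ i \<and> \<alpha> $ i < pi"
  shows "\<exists>\<epsilon> :: real^4. (\<forall>i. \<epsilon> $ i \<in> {1, -1}) \<and>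
           config_space (dual_vertex \<alpha>) = {(\<chi> i. \<epsilon> $ i * \<rho> $ i) |\<rho>. \<rho> \<in> config_space \<alpha>}"
proof (intro exI[of _ alt_sign] conjI)
  show "\<forall>i. alt_sign $ i \<in> {1, -1}"
    by (simp add: forall_4)
  \<comment> \<open>Membership so far describes a preimage under the sign change; since that map is
    its own inverse, the preimage is also the required image.\<close>
  have involution: "(\<chi> i. alt_sign $ i * (\<chi> j. alt_sign $ j * \<rho> $ j) $ i) = \<rho>" for \<rho> :: "real^4"
    by (simp add: vec_eq_iff forall_4)
  show "config_space (dual_vertex \<alpha>) = {(\<chi> i. alt_sign $ i * \<rho> $ i) |\<rho>. \<rho> \<in> config_space \<alpha>}"
  proof (intro set_eqI iffI)
    fix \<rho> assume "\<rho> \<in> config_space (dual_vertex \<alpha>)"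
    then show "\<rho> \<in> {(\<chi> i. alt_sign $ i * \<rho> $ i) |\<rho>. \<rho> \<in> config_space \<alpha>}"
      using involution[of \<rho>] by (force simp: config_space_dual_vertex_iff)
  next
    fix \<rho> assume "\<rho> \<in> {(\<chi> i. alt_sign $ i * \<rho> $ i) |\<rho>. \<rho> \<in> config_space \<alpha>}"
    then show "\<rho> \<in> config_space (dual_vertex \<alpha>)"
      using involution by (auto simp only: config_space_dual_vertex_iff mem_Collect_eq)
  qed
qed

end
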